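(* Let $G$ be a one-step $W$-groupoid, i.e. a non-commutative idempotent right modular groupoid all of whose proper subgroupoids are commutative. Then $G$ is generated by any two of its distinct elements: for all $x,y\in G$ with $x\neq y$, $\langle x,y\rangle=G$.
   Context: A groupoid is a set with a binary operation, written by juxtaposition. $W$ is the variety of idempotent right modular groupoids, i.e. groupoids satisfying $xx=x$ and $(xy)z=(zy)x$ for all $x,y,z$. A one-step $W$-groupoid is a non-commutative groupoid $G\in W$ (finite or infinite) such that every proper subgroupoid of $G$ is commutative. $\langle x,y\rangle$ denotes the subgroupoid generated by $x$ and $y$. *)

theory Defs
  imports Main
begin

definition groupoid :: "'a set \<Rightarrow> ('a \<Rightarrow> 'a \<Rightarrow> 'a) \<Rightarrow> bool" where
  "groupoid G f \<longleftrightarrow> (\<forall>x\<in>G. \<forall>y\<in>G. f x y \<in> G)"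

definition subgroupoid :: "'a set \<Rightarrow> 'a set \<Rightarrow> ('a \<Rightarrow> 'a \<Rightarrow> 'a) \<Rightarrow> bool" where
  "subgroupoid H G f \<longleftrightarrow> H \<subseteq> G \<and> groupoid H f"

definition commutative_groupoid :: "'a set \<Rightarrow> ('a \<Rightarrow> 'a \<Rightarrow> 'a) \<Rightarrow> bool" where
  "commutative_groupoid G f \<longleftrightarrow> groupoid G f \<and> (\<forall>x\<in>G. \<forall>y\<in>G. f x y = f y x)"

definition W_groupoid :: "'a set \<Rightarrow> ('a \<Rightarrow> 'a \<Rightarrow> 'a) \<Rightarrow> bool" where
  "W_groupoid G f \<longleftrightarrow> groupoid G f \<and>
     (\<forall>x\<in>G. f x x = x) \<and>
     (\<forall>x\<in>G. \<forall>y\<in>G. \<forall>z\<in>G. f (f x y) z = f (f z y) x)"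

definition one_step_W_groupoid :: "'a set \<Rightarrow> ('a \<Rightarrow> 'a \<Rightarrow> 'a) \<Rightarrow> bool" where
  "one_step_W_groupoid G f \<longleftrightarrow> W_groupoid G f \<and> \<not> commutative_groupoid G f \<and>
     (\<forall>H. subgroupoid H G f \<and> H \<noteq> G \<longrightarrow> commutative_groupoid H f)"

text \<open>The empty set counts as a subgroupoid. This is harmless: it is commutative, and
  generated subgroupoids are only taken of nonempty sets.\<close>

definition generated_subgroupoid :: "'a set \<Rightarrow> ('a \<Rightarrow> 'a \<Rightarrow> 'a) \<Rightarrow> 'a set \<Rightarrow> 'a set" where
  "generated_subgroupoid G f X = \<Inter>{H. subgroupoid H G f \<and> X \<subseteq> H}"

end

theory Submission imports Defs begin

text \<open>
  Two non-commuting elements generate \<open>G\<close>, so the point is that distinct elements never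
  commute. Commuting \<open>x \<noteq> y\<close> produce \<open>e \<noteq> x\<close> with \<open>ex = xe = e\<close>, and then the endomorphism
  \<open>g \<mapsto> ge\<close> is not surjective, so that its image is commutative: \<open>(ab)e = (ba)e\<close> for all \<open>a, b\<close>.
  The elements \<open>e\<close> with this property form an ideal, which cannot be all of \<open>G\<close>. A proper ideal is
  commutative, its elements are central in \<open>G\<close>, and it contains no product \<open>ab\<close> with \<open>ab \<noteq> ba\<close>.
  Hence \<open>e\<close> is central. A central element is a zero of \<open>G\<close>, because \<open>g \<mapsto> ge\<close> is a homomorphism
  onto a semilattice and the class of \<open>ab\<close> is an ideal, which must be \<open>G\<close>. Finally, \<open>G - {e}\<close> is
  not closed, so \<open>uv = e\<close> with \<open>u, v \<noteq> e\<close>; the annihilator of \<open>u\<close> is a proper ideal, hence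
  consists of central elements, so \<open>v\<close> would be a second zero.
\<close>

locale W_grpd =
  fixes G :: "'a set" and f :: "'a \<Rightarrow> 'a \<Rightarrow> 'a" (infixl \<open>\<cdot>\<close> 70)
  assumes W: "W_groupoid G f"
begin

lemma closed [simp, intro]: "x \<in> G \<Longrightarrow> y \<in> G \<Longrightarrow> x \<cdot> y \<in> G"
  using W by (auto simp: W_groupoid_def groupoid_def)

lemma idem [simp]: "x \<in> G \<Longrightarrow> x \<cdot> x = x"
  using W by (auto simp: W_groupoid_def)

lemma right_modular: "x \<in> G \<Longrightarrow> y \<in> G \<Longrightarrow> z \<in> G \<Longrightarrow> (x \<cdot> y) \<cdot> z = (z \<cdot> y) \<cdot> x"
  using W by (auto simp: W_groupoid_def)

lemma mult_mult_right: "x \<in> G \<Longrightarrow> y \<in> G \<Longrightarrow> (x \<cdot> y) \<cdot> y = y \<cdot> x"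
  using right_modular[of x y y] by simp

lemma medial:
  assumes "a \<in> G" "b \<in> G" "c \<in> G" "d \<in> G"
  shows "(a \<cdot> b) \<cdot> (c \<cdot> d) = (a \<cdot> c) \<cdot> (b \<cdot> d)"
proof -
  have "(a \<cdot> b) \<cdot> (c \<cdot> d) = ((c \<cdot> d) \<cdot> b) \<cdot> a"
    using assms by (intro right_modular) auto
  also have "\<dots> = ((b \<cdot> d) \<cdot> c) \<cdot> a"
    using assms by (simp add: right_modular[of c d b])
  also have "\<dots> = (a \<cdot> c) \<cdot> (b \<cdot> d)"
    using assms by (intro right_modular) auto
  finally show ?thesis .
qed

text \<open>With \<open>medial\<close>, idempotence turns right translations, and likewise left
  ones, into endomorphisms of \<open>G\<close>.\<close>

lemma distrib_right: "a \<in> G \<Longrightarrow> b \<in> G \<Longrightarrow> c \<in> G \<Longrightarrow> (a \<cdot> b) \<cdot> c = (a \<cdot> c) \<cdot> (b \<cdot> c)"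
  using medial[of a b c c] by simp

lemma distrib_left: "a \<in> G \<Longrightarrow> b \<in> G \<Longrightarrow> c \<in> G \<Longrightarrow> c \<cdot> (a \<cdot> b) = (c \<cdot> a) \<cdot> (c \<cdot> b)"
  using medial[of c c a b] by simp

lemma eq_if_mult_cyclic:
  assumes "p \<in> G" "q \<in> G" "q \<cdot> p = p" "p \<cdot> q = q"
  shows "p = q"
  using mult_mult_right[of p q] assms by simp

definition ideal :: "'a set \<Rightarrow> bool" where
  "ideal D \<longleftrightarrow> D \<subseteq> G \<and> (\<forall>s\<in>D. \<forall>g\<in>G. s \<cdot> g \<in> D)"

text \<open>One-sided ideals are two-sided, since \<open>gs = (sg)g\<close>.\<close>

lemma ideal_left:
  assumes "ideal D" "s \<in> D" "g \<in> G"
  shows "g \<cdot> s \<in> D"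
proof -
  have "s \<in> G" "(s \<cdot> g) \<cdot> g \<in> D"
    using assms by (auto simp: ideal_def)
  then show ?thesis
    using mult_mult_right[of s g] assms by simp
qed

lemma ideal_imp_subgroupoid: "ideal D \<Longrightarrow> subgroupoid D G f"
  by (auto simp: ideal_def subgroupoid_def groupoid_def)

text \<open>Both products \<open>p\<close> and \<open>q\<close> lie in \<open>D\<close>, hence
  commute; since \<open>p\<close> absorbs \<open>q\<close> and \<open>q\<close> absorbs
  \<open>p\<close>, they coincide.\<close>

lemma commutative_ideal_central:
  assumes D: "ideal D" and c: "commutative_groupoid D f" and s: "s \<in> D" and g: "g \<in> G"
  shows "s \<cdot> g = g \<cdot> s"
proof -
  define p q where "p = s \<cdot> g" and "q = g \<cdot> s"
  have pD: "p \<in> D" and qD: "q \<in> D"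
    using D s g ideal_left by (auto simp: ideal_def p_def q_def)
  have G: "s \<in> G" "p \<in> G" "q \<in> G"
    using D s pD qD by (auto simp: ideal_def)
  have comm: "\<And>x y. x \<in> D \<Longrightarrow> y \<in> D \<Longrightarrow> x \<cdot> y = y \<cdot> x"
    using c by (auto simp: commutative_groupoid_def)
  have pg: "p \<cdot> g = q" and qs: "q \<cdot> s = p"
    using mult_mult_right G g by (simp_all add: p_def q_def)
  have ps: "p \<cdot> s = p"
    using mult_mult_right[of q s] comm[OF s qD] qs G by simp
  have qp: "q \<cdot> p = q"
    using distrib_right[of p s g] ps pg G g by (simp flip: p_def)
  have pq: "p \<cdot> q = p"
    using mult_mult_right[of s q] comm[OF s qD] qs G by simp
  show ?thesis
    using comm[OF pD qD] pq qp by (simp add: p_def q_def)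
qed

definition central :: "'a \<Rightarrow> bool" where
  "central z \<longleftrightarrow> z \<in> G \<and> (\<forall>g\<in>G. z \<cdot> g = g \<cdot> z)"

text \<open>\<open>D\<close> is a semilattice. Multiplying \<open>s\<close> by \<open>a\<close> and
  \<open>b\<close> returns \<open>p\<close> and \<open>q\<close>, which places both below
  \<open>s\<close>; being their product, \<open>s\<close> is also below both.\<close>

lemma commute_if_mult_in_commutative_ideal:
  assumes D: "ideal D" and c: "commutative_groupoid D f"
    and a: "a \<in> G" and b: "b \<in> G" and ab: "a \<cdot> b \<in> D"
  shows "a \<cdot> b = b \<cdot> a"
proof -
  define p q where "p = a \<cdot> b" and "q = b \<cdot> a"
  have G: "p \<in> G" "q \<in> G"
    using a b by (auto simp: p_def q_def)
  have pb: "p \<cdot> b = q" and qa: "q \<cdot> a = p"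
    using mult_mult_right a b by (simp_all add: p_def q_def)
  have pD: "p \<in> D"
    using ab by (simp add: p_def)
  then have qD: "q \<in> D"
    using pb b D by (auto simp: ideal_def)
  define s where "s = p \<cdot> q"
  have sD: "s \<in> D" and sG: "s \<in> G"
    using pD D G by (auto simp: s_def ideal_def)
  note cen = commutative_ideal_central[OF D c]
  have qb: "q \<cdot> b = q"
    using mult_mult_right[of p b] cen[OF pD b] pb G b by simp
  have pa: "p \<cdot> a = p"
    using mult_mult_right[of q a] cen[OF qD a] qa G a by simp
  have sa: "s \<cdot> a = p"
    using distrib_right[of p q a] pa qa G a by (simp add: s_def)
  have sb: "s \<cdot> b = q"
    using distrib_right[of p q b] pb qb G b by (simp add: s_def)
  have ps: "p \<cdot> s = p"
    using mult_mult_right[of a s] cen[OF sD a] sa sG a by simp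
  have qs: "q \<cdot> s = q"
    using mult_mult_right[of b s] cen[OF sD b] sb sG b by simp
  have "p \<cdot> s = s"
    using mult_mult_right[of q p] cen[OF pD, of q] cen[OF pD, of s] G sG by (metis s_def)
  moreover have "q \<cdot> s = s"
    using mult_mult_right[of p q] cen[OF pD, of q] cen[OF qD, of s] G sG by (metis s_def)
  ultimately show ?thesis
    using ps qs by (simp add: p_def q_def)
qed

lemma ideal_commutator_annihilators:
  "ideal {h \<in> G. \<forall>a\<in>G. \<forall>b\<in>G. (a \<cdot> b) \<cdot> h = (b \<cdot> a) \<cdot> h}" (is "ideal ?T")
proof -
  have "(a \<cdot> b) \<cdot> (h \<cdot> k) = (b \<cdot> a) \<cdot> (h \<cdot> k)"
    if h: "h \<in> ?T" and k: "k \<in> G" and a: "a \<in> G" and b: "b \<in> G" for h k a b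
  proof (rule eq_if_mult_cyclic)
    \<comment> \<open>The medial law confines \<open>k\<close> to one factor, so the hypothesis on
      \<open>h\<close> can swap \<open>c\<close> and \<open>d\<close> in the other factor alone.
      Exchanging \<open>c\<close> and \<open>d\<close> then yields both premises of
      \<open>eq_if_mult_cyclic\<close>.\<close>
    have key: "((c \<cdot> d) \<cdot> (h \<cdot> k)) \<cdot> ((d \<cdot> c) \<cdot> (h \<cdot> k)) = (d \<cdot> c) \<cdot> (h \<cdot> k)"
      if "c \<in> G" "d \<in> G" for c d
    proof -
      have "((c \<cdot> d) \<cdot> (h \<cdot> k)) \<cdot> ((d \<cdot> c) \<cdot> (h \<cdot> k)) = ((c \<cdot> d) \<cdot> (d \<cdot> c)) \<cdot> (h \<cdot> k)"
        using that h k by (subst distrib_right[of "c \<cdot> d"]) auto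
      also have "\<dots> = ((c \<cdot> d) \<cdot> h) \<cdot> ((d \<cdot> c) \<cdot> k)"
        using that h k by (intro medial) auto
      also have "(c \<cdot> d) \<cdot> h = (d \<cdot> c) \<cdot> h"
        using that h by blast
      also have "((d \<cdot> c) \<cdot> h) \<cdot> ((d \<cdot> c) \<cdot> k) = (d \<cdot> c) \<cdot> (h \<cdot> k)"
        using that h k by (subst distrib_left[of h k]) auto
      finally show ?thesis .
    qed
    show "((b \<cdot> a) \<cdot> (h \<cdot> k)) \<cdot> ((a \<cdot> b) \<cdot> (h \<cdot> k)) = (a \<cdot> b) \<cdot> (h \<cdot> k)"
      and "((a \<cdot> b) \<cdot> (h \<cdot> k)) \<cdot> ((b \<cdot> a) \<cdot> (h \<cdot> k)) = (b \<cdot> a) \<cdot> (h \<cdot> k)"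
      using key a b by blast+
  qed (use h k a b in auto)
  then show ?thesis
    by (auto simp: ideal_def)
qed

end

locale one_step = W_grpd +
  assumes one_step: "one_step_W_groupoid G f"
begin

lemma subgroupoid_eq:
  assumes "subgroupoid H G f" "a \<in> H" "b \<in> H" "a \<cdot> b \<noteq> b \<cdot> a"
  shows "H = G"
  using one_step assms by (auto simp: one_step_W_groupoid_def commutative_groupoid_def)

lemma proper_commutative:
  assumes "subgroupoid H G f" "H \<noteq> G"
  shows "commutative_groupoid H f"
  using one_step assms by (auto simp: one_step_W_groupoid_def)

lemma noncommuting_pair:
  obtains a b where "a \<in> G" "b \<in> G" "a \<cdot> b \<noteq> b \<cdot> a"
  using one_step by (auto simp: one_step_W_groupoid_def commutative_groupoid_def W_groupoid_def)

lemma proper_ideal_central: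
  assumes "ideal D" "D \<noteq> G" "s \<in> D"
  shows "central s"
proof -
  have "commutative_groupoid D f"
    using assms proper_commutative ideal_imp_subgroupoid by blast
  then show ?thesis
    using commutative_ideal_central assms by (auto simp: central_def ideal_def)
qed

lemma central_imp_zero:
  assumes z: "central z" and h: "h \<in> G"
  shows "h \<cdot> z = z"
proof -
  obtain a b where a: "a \<in> G" and b: "b \<in> G" and ab: "a \<cdot> b \<noteq> b \<cdot> a"
    by (rule noncommuting_pair)
  have zG: "z \<in> G" and zc: "\<And>g. g \<in> G \<Longrightarrow> z \<cdot> g = g \<cdot> z"
    using z by (auto simp: central_def)
  have comm: "(g \<cdot> h) \<cdot> z = (h \<cdot> g) \<cdot> z" if "g \<in> G" "h \<in> G" for g h
    using right_modular[of g h z] right_modular[of h z g] right_modular[of h g z] zc that zG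
    by simp
  define m where "m = (a \<cdot> b) \<cdot> z"
  have mG: "m \<in> G"
    using a b zG by (auto simp: m_def)
  have m: "m = (a \<cdot> z) \<cdot> (b \<cdot> z)"
    using a b zG by (simp add: m_def distrib_right[of a b z])
  have abz: "(a \<cdot> z) \<cdot> (b \<cdot> z) = (b \<cdot> z) \<cdot> (a \<cdot> z)"
    using comm[OF a b] a b zG by (simp add: distrib_right[of _ _ z])
  \<comment> \<open>Elements whose image under right translation by \<open>z\<close> lies above
    \<open>m\<close>. Once this is all of \<open>G\<close>, \<open>m\<close> is the least element of
    the image.\<close>
  let ?A = "{h \<in> G. m \<cdot> (h \<cdot> z) = m}"
  have "?A = G"
  proof (rule subgroupoid_eq)
    show "subgroupoid ?A G f"
      using zG mG
      by (auto simp: subgroupoid_def groupoid_def distrib_right[of _ _ z] distrib_left[of _ _ m])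
    show "a \<in> ?A" "b \<in> ?A"
      using mult_mult_right[of "b \<cdot> z" "a \<cdot> z"] mult_mult_right[of "a \<cdot> z" "b \<cdot> z"] abz m a b zG
      by simp_all
  qed (rule ab)
  then have below: "m \<cdot> (h \<cdot> z) = m" if "h \<in> G" for h
    using that by blast
  \<comment> \<open>The fibre over the least element \<open>m\<close>, hence an ideal.\<close>
  let ?K = "{g \<in> G. g \<cdot> z = m}"
  have K: "ideal ?K"
    using below zG by (auto simp: ideal_def distrib_right[of _ _ z])
  have abK: "a \<cdot> b \<in> ?K"
    using a b by (auto simp: m_def)
  have "?K = G"
  proof (rule ccontr)
    assume "?K \<noteq> G"
    then have "commutative_groupoid ?K f"
      using K proper_commutative ideal_imp_subgroupoid by blast
    then show False
      using commute_if_mult_in_commutative_ideal[OF K _ a b abK] ab by blast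
  qed
  \<comment> \<open>The translation is constant, and idempotence of \<open>z\<close> identifies its
    value as \<open>z\<close>.\<close>
  then have "h \<cdot> z = m" "z \<cdot> z = m"
    using h zG by blast+
  then show ?thesis
    using zG by simp
qed

lemma no_central: "\<not> central e"
proof
  assume e: "central e"
  then have eG: "e \<in> G"
    by (simp add: central_def)
  have ez: "g \<cdot> e = e" "e \<cdot> g = e" if "g \<in> G" for g
    using central_imp_zero[OF e that] e that unfolding central_def by metis+
  obtain a b where a: "a \<in> G" and b: "b \<in> G" and ab: "a \<cdot> b \<noteq> b \<cdot> a"
    by (rule noncommuting_pair)
  have "\<not> subgroupoid (G - {e}) G f"
  proof
    assume "subgroupoid (G - {e}) G f"
    \<comment> \<open>A zero commutes with everything, so it is neither \<open>a\<close> nor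
      \<open>b\<close>.\<close>
    moreover have "a \<in> G - {e}" "b \<in> G - {e}"
      using a b ab ez by auto
    ultimately have "G - {e} = G"
      using ab by (rule subgroupoid_eq)
    then show False
      using eG by blast
  qed
  then obtain u v where u: "u \<in> G" "u \<noteq> e" and v: "v \<in> G" "v \<noteq> e" and uv: "u \<cdot> v = e"
    by (auto simp: subgroupoid_def groupoid_def)
  let ?N = "{g \<in> G. u \<cdot> g = e}"
  have "ideal ?N"
    using u ez by (auto simp: ideal_def distrib_left[of _ _ u])
  moreover have "?N \<noteq> G"
    using u by (metis (mono_tags, lifting) idem mem_Collect_eq)
  ultimately have "central v"
    using v uv proper_ideal_central[of ?N v] by blast
  then show False
    using central_imp_zero[of v e] ez v eG by simp
qed

lemma no_strict_order:
  assumes e: "e \<in> G" and x: "x \<in> G" and ex: "e \<cdot> x = e" and xe: "x \<cdot> e = e"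
  shows "e = x"
proof (rule ccontr)
  assume ne: "e \<noteq> x"
  let ?I = "(\<lambda>g. g \<cdot> e) ` G"
  have sub: "subgroupoid ?I G f"
    using e by (auto simp: subgroupoid_def groupoid_def simp flip: distrib_right)
  have "?I \<noteq> G"
  proof
    assume "?I = G"
    then obtain g where g: "g \<in> G" "x = g \<cdot> e"
      using x by blast
    \<comment> \<open>Both \<open>(g \<cdot> e) \<cdot> x\<close> and
      \<open>(g \<cdot> e) \<cdot> e\<close> reduce to \<open>e \<cdot> g\<close>, so
      \<open>x\<close> would equal \<open>x \<cdot> e\<close>, which is \<open>e\<close>.\<close>
    have "x = (g \<cdot> e) \<cdot> x"
      using g x by simp
    also have "\<dots> = (g \<cdot> e) \<cdot> e"
      using right_modular[of g e x] mult_mult_right[of g e] g x e xe by simp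
    finally show False
      using g xe ne by simp
  qed
  then have I: "commutative_groupoid ?I f"
    using sub proper_commutative by blast
  let ?T = "{h \<in> G. \<forall>a\<in>G. \<forall>b\<in>G. (a \<cdot> b) \<cdot> h = (b \<cdot> a) \<cdot> h}"
  have eT: "e \<in> ?T"
    using I e by (auto simp: commutative_groupoid_def distrib_right[of _ _ e])
  have "?T \<noteq> G"
  proof
    assume T: "?T = G"
    obtain a b where a: "a \<in> G" and b: "b \<in> G" and ab: "a \<cdot> b \<noteq> b \<cdot> a"
      by (rule noncommuting_pair)
    have swap: "(a \<cdot> b) \<cdot> h = (b \<cdot> a) \<cdot> h" if "h \<in> G" for h
      using T that a b by blast
    \<comment> \<open>Taking the two products themselves as \<open>h\<close> makes them absorb each
      other.\<close>
    have "a \<cdot> b = b \<cdot> a"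
      using swap[of "a \<cdot> b"] swap[of "b \<cdot> a"] a b
      by (intro eq_if_mult_cyclic[of "a \<cdot> b" "b \<cdot> a"]) simp_all
    then show False
      using ab by simp
  qed
  then show False
    using proper_ideal_central[OF ideal_commutator_annihilators _ eT] no_central by blast
qed

text \<open>The common product lies below both factors in the sense of
  \<open>no_strict_order\<close>, hence equals each of them.\<close>

lemma commute_imp_eq:
  assumes x: "x \<in> G" and y: "y \<in> G" and xy: "x \<cdot> y = y \<cdot> x"
  shows "x = y"
proof -
  have "x \<cdot> y = u" if "u \<in> G" "v \<in> G" "u \<cdot> v = v \<cdot> u" "x \<cdot> y = u \<cdot> v" for u v
  proof (rule no_strict_order)
    show "(x \<cdot> y) \<cdot> u = x \<cdot> y"
      using mult_mult_right[of v u] that by simp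
    then show "u \<cdot> (x \<cdot> y) = x \<cdot> y"
      using mult_mult_right[of "x \<cdot> y" u] that x y by simp
  qed (use that x y in auto)
  from this[of x y] this[of y x] show ?thesis
    using x y xy by simp
qed

end

theorem theorem12:
  fixes G :: "'a set" and f :: "'a \<Rightarrow> 'a \<Rightarrow> 'a"
  assumes "one_step_W_groupoid G f"
  shows "\<forall>x\<in>G. \<forall>y\<in>G. x \<noteq> y \<longrightarrow> generated_subgroupoid G f {x, y} = G"
proof (intro ballI impI)
  fix x y
  assume x: "x \<in> G" and y: "y \<in> G" and "x \<noteq> y"
  interpret one_step G f
    using assms by unfold_locales (auto simp: one_step_W_groupoid_def)
  have "f x y \<noteq> f y x"
    using commute_imp_eq x y \<open>x \<noteq> y\<close> by blast
  then have "H = G" if "subgroupoid H G f" "{x, y} \<subseteq> H" for H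
    using that subgroupoid_eq by blast
  moreover have "subgroupoid G G f" "{x, y} \<subseteq> G"
    using x y by (auto simp: subgroupoid_def groupoid_def)
  ultimately have "{H. subgroupoid H G f \<and> {x, y} \<subseteq> H} = {G}"
    by blast
  then show "generated_subgroupoid G f {x, y} = G"
    by (simp add: generated_subgroupoid_def)
qed

end
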